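(* Let $\Bbbk$ be a field and let $X$ be a (finite, bounded) polyhedral complex of dimension $d$ with $\tilde H_d(X;\Bbbk)=0$. Let $B$ be a finite set which is the disjoint union of $B_1,\ldots,B_{d+1}$, and let $\{C_i\}_{i\in B}$ be a family of induced subcomplexes of $X$ such that for every $A\subseteq B$ the intersection $\bigcap_{i\in A}C_i$ is empty or acyclic over $\Bbbk$. Let $N$ be the nerve complex of the family $\{C_i\}_{i\in B}$ and $I_N\subseteq \Bbbk[x_i]_{i\in B}$ its Stanley–Reisner ideal. If $I_N$ has square free monomials of pure color $p$ for each $p=1,\ldots,d+1$, then $I_N$ has a square free monomial of color vector $\sum_{i=1}^{d+1}e_i$.
   Context: A (bounded) polyhedral complex $X$ is a finite family of convex polytopes such that all faces of a polytope in $X$ are in $X$, and the intersection of any two polytopes in $X$ is a face of both. The subcomplex induced by a set $V'$ of vertices consists of all faces of $X$ whose vertices all lie in $V'$; an induced subcomplex is one of this form. The index sets $B_p$ are regarded as disjoint, but $C_i=C_j$ is allowed for $i\ne j$. The intersection over the empty index set is $X$. $\tilde H$ denotes reduced homology; acyclic over $\Bbbk$ means nonempty with vanishing reduced homology over $\Bbbk$. The nerve complex $N$ of $\{C_i\}_{i\in B}$ is the simplicial complex consisting of those $A\subseteq B$ such that $\bigcap_{i\in A}C_i$ is nonempty. The Stanley–Reisner ideal $I_N$ is generated by the monomials $\prod_{i\in\tau}x_i$ for $\tau\subseteq B$ with $\tau\notin N$. The variable $x_i$ has color $p$ if $i\in B_p$. A square free monomial has color vector $(a_1,\ldots,a_{d+1})$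 if it contains $a_p$ variables of color $p$ for each $p$. It has pure color $p$ if its color vector is a positive multiple of the $p$-th unit coordinate vector $e_p\in\mathbb{N}^{d+1}$. *)

theory Defs
  imports
    "HOL-Analysis.Analysis"
    "HOL-Algebra.Ideal"
    "HOL-Library.Poly_Mapping"
    "HOL-Library.Disjoint_Sets"
begin

section \<open>Polyhedral complexes\<close>

text \<open>
  In the library the empty set is a polytope of affine dimension \<open>-1\<close> and a face of
  every polytope.  Hence every complex other than \<open>{}\<close> contains the empty face, two
  polytopes of a complex may meet in it, and it is the generator in degree \<open>-1\<close> of the
  augmented chain complex below.
\<close>

definition polyhedral_complex :: "'a::euclidean_space set set \<Rightarrow> bool" where
  "polyhedral_complex X \<longleftrightarrow>
     finite X \<and>
     (\<forall>P\<in>X. polytope P) \<and>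
     (\<forall>P\<in>X. \<forall>F. F face_of P \<longrightarrow> F \<in> X) \<and>
     (\<forall>P\<in>X. \<forall>Q\<in>X. (P \<inter> Q) face_of P \<and> (P \<inter> Q) face_of Q)"

definition complex_dim :: "'a::euclidean_space set set \<Rightarrow> int" where
  "complex_dim X = Max (insert (-1) (aff_dim ` X))"

definition vertices :: "'a::euclidean_space set set \<Rightarrow> 'a set" where
  "vertices X = {v. {v} \<in> X}"

definition induced_subcomplex :: "'a::euclidean_space set set \<Rightarrow> 'a set \<Rightarrow> 'a set set" where
  "induced_subcomplex X V = {F \<in> X. {v. v extreme_point_of F} \<subseteq> V}"

text \<open>A complex is nonempty if it has a nonempty face; \<open>{{}}\<close> is empty as a space.\<close>

definition nonempty_complex :: "'a::euclidean_space set set \<Rightarrow> bool" where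
  "nonempty_complex X \<longleftrightarrow> (\<exists>F\<in>X. F \<noteq> {})"

text \<open>For subcomplexes \<open>C i\<close> of \<open>X\<close>; the intersection over the empty index set is \<open>X\<close>.\<close>

definition subcomplex_Inter ::
    "'a::euclidean_space set set \<Rightarrow> ('i \<Rightarrow> 'a set set) \<Rightarrow> 'i set \<Rightarrow> 'a set set" where
  "subcomplex_Inter X C A = X \<inter> (\<Inter>i\<in>A. C i)"

section \<open>Reduced (cellular) homology with coefficients in a field\<close>

text \<open>
  An orientation of a polytope is an ordered basis of the linear space parallel to its
  affine hull.
\<close>

definition orientation :: "'a::euclidean_space set \<Rightarrow> 'a list" where
  "orientation F =
     (SOME bs. distinct bs \<and> independent (set bs) \<and>
               span (set bs) = span {x - y |x y. x \<in> F \<and> y \<in> F})"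

text \<open>
  For bases \<open>us\<close> and \<open>bs\<close> of the same subspace, with transition matrix \<open>M\<close>, this is
  the determinant of \<open>M\<close> times the (positive) Gram determinant of \<open>bs\<close>; so it is
  positive iff \<open>us\<close> and \<open>bs\<close> are equally oriented.
\<close>

definition gram_det :: "'a::euclidean_space list \<Rightarrow> 'a list \<Rightarrow> real" where
  "gram_det us bs =
     (\<Sum>\<pi> | \<pi> permutes {..<length bs}.
        of_int (sign \<pi>) * (\<Prod>i<length bs. (us ! i) \<bullet> (bs ! \<pi> i)))"

text \<open>
  Outward vector of \<open>F\<close> along its facet \<open>G\<close>.  Modulo the linear space parallel to
  \<open>G\<close> it is determined up to a positive factor.
\<close>

definition outward_vector :: "'a::euclidean_space set \<Rightarrow> 'a set \<Rightarrow> 'a" where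
  "outward_vector F G = (SOME g. g \<in> G) - (SOME f. f \<in> F - G)"

text \<open>
  The incidence number of \<open>F\<close> and a face \<open>G\<close> of codimension one compares the
  orientation of \<open>F\<close> with the one induced on \<open>G\<close> by the rule ``outward vector first''.
  The empty face has incidence number \<open>1\<close> with each vertex (augmentation).  The
  predicate \<open>facet_of\<close> is not used because it excludes the empty face.
\<close>

definition incidence :: "'a::euclidean_space set \<Rightarrow> 'a set \<Rightarrow> int" where
  "incidence F G =
     (if G face_of F \<and> aff_dim G = aff_dim F - 1 then
        if G = {} then 1
        else if gram_det (outward_vector F G # orientation G) (orientation F) > 0 then 1
        else -1
      else 0)"

definition cell_chains ::
    "'a::euclidean_space set set \<Rightarrow> int \<Rightarrow> ('a set \<Rightarrow> 'k::field) set" where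
  "cell_chains X j = {c. \<forall>F. c F \<noteq> 0 \<longrightarrow> F \<in> X \<and> aff_dim F = j}"

definition cell_boundary ::
    "'a::euclidean_space set set \<Rightarrow> ('a set \<Rightarrow> 'k::field) \<Rightarrow> 'a set \<Rightarrow> 'k" where
  "cell_boundary X c G = (\<Sum>F\<in>X. of_int (incidence F G) * c F)"

definition cell_cycles ::
    "'a::euclidean_space set set \<Rightarrow> int \<Rightarrow> ('a set \<Rightarrow> 'k::field) set" where
  "cell_cycles X j = {c \<in> cell_chains X j. cell_boundary X c = (\<lambda>_. 0)}"

definition cell_boundaries ::
    "'a::euclidean_space set set \<Rightarrow> int \<Rightarrow> ('a set \<Rightarrow> 'k::field) set" where
  "cell_boundaries X j = cell_boundary X ` cell_chains X (j + 1)"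

definition reduced_homology_vanishes ::
    "'k::field itself \<Rightarrow> 'a::euclidean_space set set \<Rightarrow> int \<Rightarrow> bool" where
  "reduced_homology_vanishes _ X j \<longleftrightarrow>
     (cell_cycles X j :: ('a set \<Rightarrow> 'k) set) = cell_boundaries X j"

definition acyclic_over :: "'k::field itself \<Rightarrow> 'a::euclidean_space set set \<Rightarrow> bool" where
  "acyclic_over K X \<longleftrightarrow> nonempty_complex X \<and> (\<forall>j. reduced_homology_vanishes K X j)"

section \<open>Nerve and Stanley--Reisner ideal\<close>

definition nerve ::
    "'a::euclidean_space set set \<Rightarrow> 'i set \<Rightarrow> ('i \<Rightarrow> 'a set set) \<Rightarrow> 'i set set" where
  "nerve X B C = {A. A \<subseteq> B \<and> nonempty_complex (subcomplex_Inter X C A)}"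

text \<open>
  Monomials are exponent vectors \<open>'i \<Rightarrow>\<^sub>0 nat\<close>; polynomials are finitely supported
  functions on monomials, multiplied by convolution.
\<close>

definition polynomial_ring :: "'i set \<Rightarrow> (('i \<Rightarrow>\<^sub>0 nat) \<Rightarrow>\<^sub>0 'k::field) ring" where
  "polynomial_ring B =
     \<lparr>carrier = {f. \<forall>m \<in> Poly_Mapping.keys f. Poly_Mapping.keys m \<subseteq> B},
      mult = (*), one = 1, zero = 0, add = (+)\<rparr>"

definition monom_poly :: "('i \<Rightarrow>\<^sub>0 nat) \<Rightarrow> (('i \<Rightarrow>\<^sub>0 nat) \<Rightarrow>\<^sub>0 'k::field)" where
  "monom_poly m = Poly_Mapping.single m 1"

definition var_poly :: "'i \<Rightarrow> (('i \<Rightarrow>\<^sub>0 nat) \<Rightarrow>\<^sub>0 'k::field)" where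
  "var_poly i = monom_poly (Poly_Mapping.single i 1)"

definition stanley_reisner_ideal ::
    "'i set \<Rightarrow> 'i set set \<Rightarrow> (('i \<Rightarrow>\<^sub>0 nat) \<Rightarrow>\<^sub>0 'k::field) set" where
  "stanley_reisner_ideal B N =
     genideal (polynomial_ring B) {\<Prod>i\<in>\<tau>. var_poly i |\<tau>. \<tau> \<subseteq> B \<and> \<tau> \<notin> N}"

definition squarefree_monomial :: "'i set \<Rightarrow> ('i \<Rightarrow>\<^sub>0 nat) \<Rightarrow> bool" where
  "squarefree_monomial B m \<longleftrightarrow>
     Poly_Mapping.keys m \<subseteq> B \<and> (\<forall>i. Poly_Mapping.lookup m i \<le> 1)"

text \<open>
  Color vectors are functions of the color \<open>p\<close>, of which only the values at
  \<open>p \<in> {1..n}\<close> matter, \<open>n\<close> being the number of colors.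
\<close>

definition has_color_vector ::
    "nat \<Rightarrow> (nat \<Rightarrow> 'i set) \<Rightarrow> ('i \<Rightarrow>\<^sub>0 nat) \<Rightarrow> (nat \<Rightarrow> nat) \<Rightarrow> bool" where
  "has_color_vector n Bc m a \<longleftrightarrow>
     (\<forall>p\<in>{1..n}. card {i \<in> Bc p. i \<in> Poly_Mapping.keys m} = a p)"

definition unit_vector :: "nat \<Rightarrow> nat \<Rightarrow> nat" where
  "unit_vector p q = (if q = p then 1 else 0)"

definition has_pure_color ::
    "nat \<Rightarrow> (nat \<Rightarrow> 'i set) \<Rightarrow> ('i \<Rightarrow>\<^sub>0 nat) \<Rightarrow> nat \<Rightarrow> bool" where
  "has_pure_color n Bc m p \<longleftrightarrow>
     (\<exists>c>0. has_color_vector n Bc m (\<lambda>q. c * unit_vector p q))"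

end

theory Submission
  imports Defs
begin

text \<open>
  Call a set of indices rainbow if it has at most one index of each of the \<open>n = d + 1\<close> colors.
  A monomial lies in the Stanley--Reisner ideal iff its support contains a nonface of the
  nerve (\<open>monom_poly_in_ideal_imp_nonface\<close>, \<open>nonface_imp_monom_poly_in_ideal\<close>).  So the
  hypothesis on pure colors says that no color class is a face of the nerve, and if the
  conclusion fails, then every rainbow set is a face, and its intersection is acyclic.  The
  proof compares \<open>X\<close> with the product \<open>W\<close> of the color classes in two ways and obtains
  two values for one number.

  Into \<open>X\<close>: Let \<open>b \<in> W\<close> be a base point.  Each \<open>x \<in> W\<close> spans an \<open>n\<close>-dimensional cube, the
  product of abstract edges from \<open>b p\<close> to \<open>x p\<close>.  A face of the cube has some free
  coordinates and some fixed ones, and the fixed ones form a rainbow set.  As the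
  intersections over rainbow sets are acyclic, there is a chain map \<open>g\<close> from the faces of
  dimension less than \<open>n\<close> to \<open>X\<close> such that each face with fixed coordinates \<open>A\<close> goes to a
  chain in the intersection over \<open>A\<close> (\<open>cube_filling_exists\<close>).  The boundary of a whole cube
  goes to a cycle of dimension \<open>d\<close> in \<open>X\<close>.  It is zero, because \<open>X\<close> has no faces of
  dimension \<open>d + 1\<close> and no homology in degree \<open>d\<close>.

  Out of \<open>X\<close>: A color class is not a face of the nerve, so every nonempty face \<open>F\<close> of \<open>X\<close>
  has an index \<open>pt F p\<close> of color \<open>p\<close> with \<open>F \<notin> C (pt F p)\<close>.  This gives a point
  \<open>pt F \<in> W\<close>, and taking successively the cone over the image of the boundary of \<open>F\<close> with
  apex \<open>pt F\<close> defines a chain map from \<open>X\<close> to the ordered simplices on \<open>W\<close>.  Dually,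
  cochains on tuples of elements of \<open>W\<close> can be pulled back to \<open>X\<close> (\<open>pull_cobd\<close>).  The
  chains in \<open>C x\<close> go to tuples whose points avoid the index \<open>x\<close>.

  Let \<open>[x]\<close> be the 0-cochain on \<open>W\<close> that is \<open>1\<close> at the points with coordinate \<open>x\<close> in the
  color of \<open>x\<close>, and let \<open>\<delta>\<close> be the coboundary.  Evaluate the cochain
  \<open>[x 1] \<union> \<delta>[x 2] \<union> \<dots> \<union> \<delta>[x n]\<close> on the image of the boundary of the cube of \<open>x\<close>, and
  sum over all \<open>x \<in> W\<close>.  A facet that fixes coordinate \<open>p\<close> at \<open>x p\<close> contributes \<open>0\<close>, as its
  image avoids \<open>x p\<close>.  The facets that fix coordinate \<open>p \<noteq> 1\<close> at \<open>b p\<close> cancel, since the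
  cochains \<open>[y]\<close> with \<open>y\<close> of color \<open>p\<close> add up to the constant \<open>1\<close>, whose coboundary is
  \<open>0\<close>.  For \<open>p = 1\<close> they add up to the value of \<open>\<delta>[x 2] \<union> \<dots> \<union> \<delta>[x n]\<close>, the
  coboundary of \<open>[x 2] \<union> \<delta>[x 3] \<union> \<dots> \<union> \<delta>[x n]\<close>, and by Stokes's formula the number is up
  to sign the same one with a color less.  Down to the augmentation of a vertex this gives
  \<open>(- 1) ^ n\<close> (\<open>top_evaluation\<close>).  But the image of each boundary is \<open>0\<close>.

  That the boundary operator of \<open>X\<close> squares to zero is a part of the acyclicity of \<open>X\<close>, which
  is the intersection over the empty set: in each degree the boundaries are the cycles.
\<close>

section \<open>Cochains on tuples\<close>

text \<open>
  The simplicial coboundary, augmented in degree \<open>-1\<close>: the alternating sum of the values at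
  the tuples with one entry left out.  The recursion takes off the first entry, which is the
  apex of a cone when cochains are pulled back to a complex.
\<close>

primrec cobd :: "('w list \<Rightarrow> 'k::field) \<Rightarrow> 'w list \<Rightarrow> 'k" where
  "cobd f [] = 0"
| "cobd f (w # l) = f l - cobd (\<lambda>l'. f (w # l')) l"

lemma cobd_diff: "cobd (\<lambda>l. f l - g l) l = cobd f l - cobd g l"
  by (induction l arbitrary: f g) auto

lemma cobd_scale: "cobd (\<lambda>l. a * f l) l = a * cobd f l"
  by (induction l arbitrary: f) (auto simp: algebra_simps)

lemma cobd_cobd: "cobd (cobd f) l = 0"
proof (induction l arbitrary: f)
  case (Cons w l)
  have "cobd (cobd f) (w # l) = cobd f l - cobd (\<lambda>l'. f l' - cobd (\<lambda>l''. f (w # l'')) l') l"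
    by simp
  also have "\<dots> = cobd (cobd (\<lambda>l''. f (w # l''))) l"
    by (simp add: cobd_diff)
  finally show ?case
    using Cons.IH by simp
qed simp

text \<open>
  For \<open>xs = [x\<^sub>0, \<dots>, x\<^sub>k]\<close> this is the cup product
  \<open>[x\<^sub>0] \<union> \<delta>[x\<^sub>1] \<union> \<dots> \<union> \<delta>[x\<^sub>k]\<close>, where \<open>x\<^sub>i\<close> is compared with the coordinate of color
  \<open>p + i\<close>: the product \<open>\<delta>[x\<^sub>1] \<union> \<dots> \<union> \<delta>[x\<^sub>k]\<close> of cocycles is the coboundary of the cochain of
  the shorter list.  For the empty list it is the unit in degree \<open>-1\<close>, whose
  coboundary is the constant \<open>1\<close> in degree \<open>0\<close>.
\<close>

primrec rainbow_cochain :: "nat \<Rightarrow> 'i list \<Rightarrow> (nat \<Rightarrow> 'i) list \<Rightarrow> 'k::field" where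
  "rainbow_cochain p [] = (\<lambda>l. of_bool (l = []))"
| "rainbow_cochain p (x # xs) =
     (\<lambda>l. if l = [] then 0 else of_bool (hd l p = x) * cobd (rainbow_cochain (Suc p) xs) l)"

text \<open>
  The Leibniz rule for \<open>[x] \<union> c\<close> with a cocycle \<open>c\<close>.
\<close>

lemma cobd_rainbow_Cons:
  "cobd (rainbow_cochain p (x # xs)) (v # w # l) =
     (of_bool (w p = x) - of_bool (v p = x)) * (cobd (rainbow_cochain (Suc p) xs) (w # l) :: 'k::field)"
proof -
  define h where "h = cobd (rainbow_cochain (Suc p) xs :: _ \<Rightarrow> 'k)"
  have "h (w # l) - cobd (\<lambda>l'. h (v # l')) (w # l) = cobd h (v # w # l)"
    by simp
  also have "\<dots> = 0"
    unfolding h_def by (rule cobd_cobd)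
  finally have "cobd (\<lambda>l'. h (v # l')) (w # l) = h (w # l)"
    by simp
  moreover have "cobd (rainbow_cochain p (x # xs)) (v # w # l) =
      of_bool (w p = x) * h (w # l) - cobd (\<lambda>l'. of_bool (v p = x) * h (v # l')) (w # l)"
    by (subst cobd.simps(2)) (simp only: rainbow_cochain.simps list.sel list.simps if_False h_def)
  ultimately show ?thesis
    by (simp add: cobd_scale h_def algebra_simps del: cobd.simps(2))
qed

lemma cobd_rainbow_single: "cobd (rainbow_cochain p (x # xs)) [w] = 0"
  by simp

text \<open>
  One factor of the cup product is \<open>\<delta>[x]\<close> for the entry \<open>x\<close> of \<open>xs\<close> in position \<open>q\<close>, and the
  cochain \<open>[x]\<close> vanishes on points that avoid \<open>x\<close>.
\<close>

lemma cobd_rainbow_avoid: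
  assumes "q < length xs" "\<forall>w\<in>set l. w (p + q) \<noteq> xs ! q"
  shows "cobd (rainbow_cochain p xs) l = (0 :: 'k::field)"
  using assms
proof (induction xs arbitrary: p q l)
  case (Cons x xs)
  show ?case
  proof (cases l)
    case l: (Cons v l')
    show ?thesis
    proof (cases l')
      case Nil
      then show ?thesis
        using l cobd_rainbow_single by simp
    next
      case l': (Cons w l'')
      show ?thesis
      proof (cases q)
        case 0
        then show ?thesis
          using Cons.prems unfolding l l' by (subst cobd_rainbow_Cons) simp
      next
        case (Suc q')
        then have "cobd (rainbow_cochain (Suc p) xs) (w # l'') = (0 :: 'k)"
          using Cons.prems by (intro Cons.IH[of q']) (auto simp: l l')
        then show ?thesis
          unfolding l l' by (subst cobd_rainbow_Cons) simp
      qed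
    qed
  qed simp
qed simp

text \<open>
  The sum of the cochains \<open>[x]\<close> over a whole color class is constant, so the factors
  \<open>\<delta>[x]\<close> in position \<open>q\<close> add up to zero.
\<close>

lemma cobd_rainbow_sum:
  assumes "q < length xs" "\<forall>w\<in>set l. w (p + q) \<in> S" "finite S"
  shows "(\<Sum>x\<in>S. cobd (rainbow_cochain p (xs[q := x])) l) = (0 :: 'k::field)"
  using assms(1,2)
proof (induction xs arbitrary: p q l)
  case (Cons y xs)
  show ?case
  proof (cases l)
    case l: (Cons v l')
    show ?thesis
    proof (cases l')
      case Nil
      have "cobd (rainbow_cochain p ((y # xs)[q := x])) [v] = (0 :: 'k)" for x
        by (cases q) (simp_all only: list_update.simps nat.case cobd_rainbow_single)
      then show ?thesis
        using l Nil by simp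
    next
      case l': (Cons w l'')
      show ?thesis
      proof (cases q)
        case 0
        have "(\<Sum>x\<in>S. of_bool (u = x)) = (1 :: 'k)" if "u \<in> S" for u
          using that assms(3) by (simp add: of_bool_def)
        then have "(\<Sum>x\<in>S. of_bool (w p = x) - of_bool (v p = x)) = (0 :: 'k)"
          using Cons.prems 0 by (simp add: sum_subtractf l l')
        then have "(\<Sum>x\<in>S. (of_bool (w p = x) - of_bool (v p = x)) *
            cobd (rainbow_cochain (Suc p) xs) (w # l'')) = (0 :: 'k)"
          unfolding sum_distrib_right[symmetric] by simp
        then show ?thesis
          unfolding l l' by (simp only: 0 list_update.simps nat.case cobd_rainbow_Cons)
      next
        case (Suc q')
        then have "(\<Sum>x\<in>S. cobd (rainbow_cochain (Suc p) (xs[q' := x])) (w # l'')) = (0 :: 'k)"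
          using Cons.prems by (intro Cons.IH) (auto simp: l l')
        then show ?thesis
          unfolding l l'
          by (simp only: Suc list_update.simps nat.case cobd_rainbow_Cons
              sum_distrib_left[symmetric] mult_zero_right)
      qed
    qed
  qed simp
qed simp

section \<open>Pulling cochains back to a cell complex\<close>

text \<open>
  Only the incidence matrix of the complex enters.  The label \<open>pt F\<close> is the apex of the cone
  that is the image of \<open>F\<close>.
\<close>

locale labelled_complex =
  fixes X :: "'f set" and inc :: "'f \<Rightarrow> 'f \<Rightarrow> 'k::field" and pt :: "'f \<Rightarrow> 'w"
  assumes square_zero: "\<And>F H. F \<in> X \<Longrightarrow> H \<in> X \<Longrightarrow> (\<Sum>G\<in>X. inc F G * inc G H) = 0"
begin

text \<open>
  The value of the pulled back cochain at a face \<open>F\<close> of dimension \<open>n - 1\<close>: the image of \<open>F\<close>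
  is the sum of the tuples \<open>(pt F, pt G, pt H, \<dots>)\<close> of length \<open>n\<close> over the flags
  \<open>F \<supset> G \<supset> H \<supset> \<dots>\<close> down to the vertices, with the product of the incidence numbers as coefficient.
\<close>

primrec pull :: "nat \<Rightarrow> ('w list \<Rightarrow> 'k) \<Rightarrow> 'f \<Rightarrow> 'k" where
  "pull 0 f F = f []"
| "pull (Suc n) f F = (\<Sum>G\<in>X. inc F G * pull n (\<lambda>l. f (pt F # l)) G)"

lemma pull_diff: "pull n (\<lambda>l. f l - g l) F = pull n f F - pull n g F"
  by (induction n arbitrary: f g F) (simp_all add: right_diff_distrib sum_subtractf)

lemma pull_sum: "pull n (\<lambda>l. \<Sum>x\<in>S. f x l) F = (\<Sum>x\<in>S. pull n (f x) F)"
proof (induction n arbitrary: f F)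
  case (Suc n)
  then show ?case
    by (simp add: sum_distrib_left) (rule sum.swap)
qed simp

text \<open>
  Pulling back commutes with the coboundary.  This is the identity
  \<open>\<partial>(v * c) = c - v * \<partial>c\<close> for the cone over \<open>c = \<partial>F\<close>; the last term disappears because the
  incidence matrix squares to zero.
\<close>

lemma pull_cobd:
  "F \<in> X \<Longrightarrow> (\<Sum>G\<in>X. inc F G * pull n f G) = pull (Suc n) (cobd f) F"
proof (induction n arbitrary: f F)
  case (Suc n)
  define f' where "f' = (\<lambda>l. f (pt F # l))"
  have "(\<Sum>G\<in>X. inc F G * pull (Suc n) (cobd f') G) =
      (\<Sum>G\<in>X. \<Sum>H\<in>X. inc F G * inc G H * pull n f' H)"
    using Suc.IH[of _ f', symmetric] by (simp add: sum_distrib_left mult.assoc del: pull.simps)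
  also have "\<dots> = (\<Sum>H\<in>X. (\<Sum>G\<in>X. inc F G * inc G H) * pull n f' H)"
    by (subst sum.swap) (simp add: sum_distrib_right)
  also have "\<dots> = 0"
    using square_zero Suc.prems by simp
  finally have "(\<Sum>G\<in>X. inc F G * pull (Suc n) (cobd f') G) = 0" .
  moreover have "pull (Suc (Suc n)) (cobd f) F =
      (\<Sum>G\<in>X. inc F G * pull (Suc n) (\<lambda>l. f l - cobd f' l) G)"
    by (simp only: pull.simps(2)[of "Suc n"] cobd.simps f'_def)
  ultimately show ?case
    by (simp add: pull_diff right_diff_distrib sum_subtractf del: pull.simps)
qed simp

text \<open>
  The flags below a face of a subcomplex \<open>Y\<close> stay in \<open>Y\<close>, so the image of that face has only
  labels of faces of \<open>Y\<close> as entries.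
\<close>

lemma pull_eq_0:
  assumes closed: "\<And>F G. F \<in> Y \<Longrightarrow> G \<in> X \<Longrightarrow> inc F G \<noteq> 0 \<Longrightarrow> G \<in> Y \<and> Q (pt F)"
    and "\<And>l. \<forall>w\<in>set l. Q w \<Longrightarrow> f l = 0" and "F \<in> Y"
  shows "pull n f F = 0"
  using assms(2,3)
proof (induction n arbitrary: f F)
  case (Suc n)
  have "inc F G * pull n (\<lambda>l. f (pt F # l)) G = 0" if "G \<in> X" for G
  proof (cases "inc F G = 0")
    case False
    then have "G \<in> Y" "Q (pt F)"
      using closed Suc.prems(2) that by auto
    then show ?thesis
      using Suc.IH Suc.prems(1) by simp
  qed simp
  then show ?case
    by (simp add: sum.neutral del: mult_eq_0_iff)
qed simp

definition pairing :: "nat \<Rightarrow> ('w list \<Rightarrow> 'k) \<Rightarrow> ('f \<Rightarrow> 'k) \<Rightarrow> 'k" where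
  "pairing n f z = (\<Sum>F\<in>X. z F * pull n f F)"

text \<open>
  Stokes's formula for the pulled back cochains.
\<close>

lemma pairing_boundary:
  "pairing n f (\<lambda>G. \<Sum>F\<in>X. inc F G * z F) = pairing (Suc n) (cobd f) z"
proof -
  have "pairing n f (\<lambda>G. \<Sum>F\<in>X. inc F G * z F) =
      (\<Sum>F\<in>X. \<Sum>G\<in>X. z F * (inc F G * pull n f G))"
    unfolding pairing_def sum_distrib_right by (subst sum.swap) (simp add: algebra_simps)
  also have "\<dots> = pairing (Suc n) (cobd f) z"
    unfolding pairing_def sum_distrib_left[symmetric]
    by (intro sum.cong refl arg_cong2[where f = "(*)"] pull_cobd)
  finally show ?thesis .
qed

lemma pairing_sum: "pairing n (\<lambda>l. \<Sum>x\<in>S. f x l) z = (\<Sum>x\<in>S. pairing n (f x) z)"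
  unfolding pairing_def pull_sum sum_distrib_left by (rule sum.swap)

end

section \<open>Cubes\<close>

text \<open>
  A list of sides is a face of a cube, with one side for each color: the coordinate is fixed
  at \<open>x\<close>, or it runs along an abstract edge from the base point \<open>b p\<close> to \<open>x\<close>.
\<close>

datatype 'i side = Fix 'i | Edge 'i

primrec side_label :: "'i side \<Rightarrow> 'i" where
  "side_label (Fix x) = x"
| "side_label (Edge x) = x"

primrec cube_dim :: "'i side list \<Rightarrow> nat" where
  "cube_dim [] = 0"
| "cube_dim (s # e) = (case s of Fix _ \<Rightarrow> cube_dim e | Edge _ \<Rightarrow> Suc (cube_dim e))"

definition fixed :: "'i side list \<Rightarrow> 'i set" where
  "fixed e = {x. Fix x \<in> set e}"

lemma fixed_simps [simp]:
  "fixed [] = {}" "fixed (Fix x # e) = insert x (fixed e)" "fixed (Edge x # e) = fixed e"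
  "fixed (map Edge xs) = {}"
  by (auto simp: fixed_def)

text \<open>
  The entry in position \<open>i\<close> has color \<open>p + i\<close>; so transversals of length \<open>n\<close> starting at
  color \<open>p\<close> are the points of the product of \<open>n\<close> color classes.
\<close>

primrec transversal :: "(nat \<Rightarrow> 'i set) \<Rightarrow> nat \<Rightarrow> 'i list \<Rightarrow> bool" where
  "transversal col p [] \<longleftrightarrow> True"
| "transversal col p (x # xs) \<longleftrightarrow> x \<in> col p \<and> transversal col (Suc p) xs"

lemma transversal_nth: "transversal col p xs \<Longrightarrow> q < length xs \<Longrightarrow> xs ! q \<in> col (p + q)"
proof (induction xs arbitrary: p q)
  case (Cons x xs)
  then show ?case
    by (cases q) (auto dest: Cons.IH)
qed simp

primrec cube_faces :: "(nat \<Rightarrow> 'i) \<Rightarrow> nat \<Rightarrow> 'i side list \<Rightarrow> 'i side list set" where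
  "cube_faces b p [] = {}"
| "cube_faces b p (s # e) = (#) s ` cube_faces b (Suc p) e \<union>
     (case s of Fix _ \<Rightarrow> {} | Edge x \<Rightarrow> {Fix x # e, Fix (b p) # e})"

text \<open>
  The value at \<open>\<partial>e\<close> of the linear extension of \<open>f\<close>.  Boundaries are only ever used through
  functions on faces, which makes formal sums of faces superfluous.
\<close>

primrec cube_bd :: "(nat \<Rightarrow> 'i) \<Rightarrow> nat \<Rightarrow> ('i side list \<Rightarrow> 'k::field) \<Rightarrow> 'i side list \<Rightarrow> 'k" where
  "cube_bd b p f [] = 0"
| "cube_bd b p f (s # e) = (case s of
       Fix x \<Rightarrow> cube_bd b (Suc p) (\<lambda>e'. f (Fix x # e')) e
     | Edge x \<Rightarrow> f (Fix x # e) - f (Fix (b p) # e) - cube_bd b (Suc p) (\<lambda>e'. f (Edge x # e')) e)"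

lemma cube_bd_cong:
  "(\<And>e'. e' \<in> cube_faces b p e \<Longrightarrow> f e' = g e') \<Longrightarrow> cube_bd b p f e = cube_bd b p g e"
proof (induction e arbitrary: p f g)
  case (Cons s e)
  then have "cube_bd b (Suc p) (\<lambda>e'. f (s # e')) e = cube_bd b (Suc p) (\<lambda>e'. g (s # e')) e"
    by (intro Cons.IH Cons.prems) auto
  then show ?case
    using Cons.prems by (auto split: side.split)
qed simp

text \<open>
  For an edge this says that its boundary has augmentation zero, which makes the image of the
  boundary a cycle.
\<close>

lemma cube_bd_const: "cube_bd b p (\<lambda>_. a) e = 0"
  by (induction e arbitrary: p) (auto split: side.split)

lemma cube_bd_diff:
  "cube_bd b p (\<lambda>e. f e - g e) e = cube_bd b p f e - cube_bd b p g e"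
  by (induction e arbitrary: p f g) (auto split: side.split)

lemma cube_bd_linear:
  "cube_bd b p (\<lambda>e. \<Sum>y\<in>S. f y e * a y) e = (\<Sum>y\<in>S. cube_bd b p (f y) e * a y)"
  by (induction e arbitrary: p f)
    (auto split: side.split simp: sum_subtractf left_diff_distrib)

lemma cube_bd_cube_bd: "cube_bd b p (cube_bd b p f) e = 0"
proof (induction e arbitrary: p f)
  case (Cons s e)
  then show ?case
    by (cases s) (simp_all add: cube_bd_diff)
qed simp

lemma cube_faces_dim: "e' \<in> cube_faces b p e \<Longrightarrow> cube_dim e = Suc (cube_dim e')"
  by (induction e arbitrary: p e') (auto split: side.splits)

lemma cube_faces_fixed: "e' \<in> cube_faces b p e \<Longrightarrow> fixed e \<subseteq> fixed e'"
  by (induction e arbitrary: p e') (fastforce split: side.splits simp: fixed_def)+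

lemma cube_faces_length: "e' \<in> cube_faces b p e \<Longrightarrow> length e' = length e"
  by (induction e arbitrary: p e') (auto split: side.splits)

lemma cube_faces_transversal:
  assumes "\<And>p. b p \<in> col p"
  shows "e' \<in> cube_faces b p e \<Longrightarrow> transversal col p (map side_label e) \<Longrightarrow>
    transversal col p (map side_label e')"
  using assms by (induction e arbitrary: p e') (auto split: side.splits)

lemma fixed_label: "fixed e \<subseteq> side_label ` set e"
  by (force simp: fixed_def)

lemma cube_dim_Edge: "cube_dim (map Edge xs) = length xs"
  by (induction xs) auto

lemma cube_dim_less: "fixed e \<noteq> {} \<Longrightarrow> cube_dim e < length e"
proof (induction e)
  case (Cons s e)
  have "cube_dim e \<le> length e"
    by (induction e) (auto split: side.split)
  with Cons show ?case
    by (cases s) (auto simp: fixed_def)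
qed (simp add: fixed_def)

text \<open>
  The sum over all transversals of length \<open>n\<close> that start at color \<open>p\<close>.
\<close>

primrec tsum :: "(nat \<Rightarrow> 'i set) \<Rightarrow> nat \<Rightarrow> nat \<Rightarrow> ('i list \<Rightarrow> 'k::field) \<Rightarrow> 'k" where
  "tsum col 0 p f = f []"
| "tsum col (Suc n) p f = (\<Sum>x\<in>col p. tsum col n (Suc p) (\<lambda>xs. f (x # xs)))"

lemma tsum_cong:
  "(\<And>xs. transversal col p xs \<Longrightarrow> length xs = n \<Longrightarrow> f xs = g xs) \<Longrightarrow>
    tsum col n p f = tsum col n p g"
proof (induction n arbitrary: p f g)
  case (Suc n)
  have "tsum col n (Suc p) (\<lambda>xs. f (x # xs)) = tsum col n (Suc p) (\<lambda>xs. g (x # xs))"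
    if "x \<in> col p" for x
    using that by (intro Suc.IH Suc.prems) auto
  then show ?case
    by simp
qed simp

lemma tsum_0: "tsum col n p (\<lambda>_. 0) = 0"
  by (induction n arbitrary: p) auto

lemma tsum_eq_0:
  assumes "\<And>xs. transversal col p xs \<Longrightarrow> length xs = n \<Longrightarrow> f xs = 0"
  shows "tsum col n p f = 0"
  using tsum_cong[of col p n f "\<lambda>_. 0"] assms tsum_0 by metis

lemma tsum_diff: "tsum col n p (\<lambda>xs. f xs - g xs) = tsum col n p f - tsum col n p g"
  by (induction n arbitrary: p f g) (simp_all add: sum_subtractf)

lemma tsum_sum: "(\<Sum>x\<in>S. tsum col n p (f x)) = tsum col n p (\<lambda>xs. \<Sum>x\<in>S. f x xs)"
proof (induction n arbitrary: p f)
  case (Suc n)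
  have "(\<Sum>x\<in>S. tsum col (Suc n) p (f x)) =
      (\<Sum>y\<in>col p. \<Sum>x\<in>S. tsum col n (Suc p) (\<lambda>xs. f x (y # xs)))"
    unfolding tsum.simps by (rule sum.swap)
  also have "\<dots> = tsum col (Suc n) p (\<lambda>xs. \<Sum>x\<in>S. f x xs)"
    unfolding Suc.IH tsum.simps ..
  finally show ?case .
qed simp

section \<open>Evaluation on the top cubes\<close>

text \<open>
  The subcomplexes \<open>C x\<close> and the label \<open>pt F\<close>, which in each color is an index \<open>x\<close> with
  \<open>F \<notin> C x\<close>.  The premises on \<open>inc\<close> exclude the empty face, which goes to the empty tuple and
  not to a cone.
\<close>

locale coloured_complex = labelled_complex X inc pt
  for X :: "'f set" and inc :: "'f \<Rightarrow> 'f \<Rightarrow> 'k::field" and pt :: "'f \<Rightarrow> nat \<Rightarrow> 'i" +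
  fixes C :: "'i \<Rightarrow> 'f set" and col :: "nat \<Rightarrow> 'i set" and b :: "nat \<Rightarrow> 'i"
  assumes finite_col: "\<And>p. finite (col p)"
    and base: "\<And>p. b p \<in> col p"
    and pt_col: "\<And>F G p. F \<in> X \<Longrightarrow> inc F G \<noteq> 0 \<Longrightarrow> pt F p \<in> col p"
    and pt_avoid: "\<And>F G p. F \<in> X \<Longrightarrow> inc F G \<noteq> 0 \<Longrightarrow> F \<notin> C (pt F p)"
    and closed: "\<And>F G p x. F \<in> X \<Longrightarrow> G \<in> X \<Longrightarrow> inc F G \<noteq> 0 \<Longrightarrow> x \<in> col p \<Longrightarrow> F \<in> C x \<Longrightarrow> G \<in> C x"
begin

lemma pairing_eq_0:
  assumes "\<And>l. \<forall>w\<in>set l. \<forall>p. w p \<in> col p \<Longrightarrow> f l = 0"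
  shows "pairing n f z = 0"
proof -
  have "pull n f F = 0" if "F \<in> X" for F
    by (rule pull_eq_0[where Y = X and Q = "\<lambda>w. \<forall>p. w p \<in> col p"])
      (use assms that pt_col in auto)
  then show ?thesis
    by (simp add: pairing_def)
qed

text \<open>
  A face in \<open>C x\<close> and all its faces have labels that avoid \<open>x\<close>.
\<close>

lemma pairing_avoid_eq_0:
  assumes "x \<in> col p" and "\<And>F. F \<in> X \<Longrightarrow> z F \<noteq> 0 \<Longrightarrow> F \<in> C x"
    and "\<And>l. \<forall>w\<in>set l. \<forall>p. w p \<noteq> x \<Longrightarrow> f l = 0"
  shows "pairing n f z = 0"
proof -
  have "pull n f F = 0" if "F \<in> X" "F \<in> C x" for F
    by (rule pull_eq_0[where Y = "X \<inter> C x" and Q = "\<lambda>w. \<forall>p. w p \<noteq> x"])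
      (use assms that pt_avoid closed in auto)
  then have "z F * pull n f F = 0" if "F \<in> X" for F
    using assms(2) that by (cases "z F = 0") auto
  then show ?thesis
    by (simp add: pairing_def sum.neutral del: mult_eq_0_iff)
qed

text \<open>
  The lists have length \<open>n\<close> and their first side has color \<open>p\<close>.
\<close>

definition carried :: "nat \<Rightarrow> nat \<Rightarrow> ('i side list \<Rightarrow> 'f \<Rightarrow> 'k) \<Rightarrow> bool" where
  "carried n p g \<longleftrightarrow> (\<forall>e F. length e = n \<longrightarrow> transversal col p (map side_label e) \<longrightarrow>
     F \<in> X \<longrightarrow> g e F \<noteq> 0 \<longrightarrow> (\<forall>x\<in>fixed e. F \<in> C x))"

lemma carried_Cons:
  "carried (Suc n) p g \<Longrightarrow> side_label s \<in> col p \<Longrightarrow> carried n (Suc p) (\<lambda>e. g (s # e))"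
  unfolding carried_def by (force simp: fixed_def)

lemma transversal_Edge: "transversal col p (map side_label (map Edge xs)) = transversal col p xs"
  by (simp add: comp_def)

text \<open>
  Applied with the first side kept free, this says that the facets whose fixed coordinate is
  not the first one cancel: a facet fixed
  at an entry of \<open>xs\<close> is mapped to points that avoid this entry, and for the facets fixed at
  the base point the sum over the entry that has disappeared from the facet vanishes.  The two
  assumptions on \<open>K\<close> are the two properties of a factor \<open>\<delta>[x]\<close>; stated for any \<open>K\<close>, they
  survive the induction on the number of colors, which moves factors into a prefix of \<open>K\<close>.
\<close>

lemma boundary_terms_cancel:
  assumes "carried m p g"
    and "\<And>xs l q. transversal col p xs \<Longrightarrow> length xs = m \<Longrightarrow> q < m \<Longrightarrow>
           \<forall>w\<in>set l. \<forall>p. w p \<noteq> xs ! q \<Longrightarrow> K xs l = 0"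
    and "\<And>xs l q. transversal col p xs \<Longrightarrow> length xs = m \<Longrightarrow> q < m \<Longrightarrow>
           \<forall>w\<in>set l. \<forall>p. w p \<in> col p \<Longrightarrow> (\<Sum>x\<in>col (p + q). K (xs[q := x]) l) = 0"
  shows "tsum col m p (\<lambda>xs. cube_bd b p (\<lambda>e. pairing n (K xs) (g e)) (map Edge xs)) = 0"
  using assms
proof (induction m arbitrary: p g K)
  case (Suc m)
  have 1: "pairing n (K (x # xs)) (g (Fix x # map Edge xs)) = 0"
    if "x \<in> col p" "transversal col (Suc p) xs" "length xs = m" for x xs
  proof (rule pairing_avoid_eq_0)
    show "F \<in> C x" if "F \<in> X" "g (Fix x # map Edge xs) F \<noteq> 0" for F
      using that Suc.prems(1) \<open>x \<in> col p\<close> \<open>transversal col (Suc p) xs\<close> \<open>length xs = m\<close>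
      unfolding carried_def
      by (auto simp: fixed_def comp_def dest!: spec[of _ "Fix x # map Edge xs"])
    show "K (x # xs) l = 0" if "\<forall>w\<in>set l. \<forall>p. w p \<noteq> x" for l
      using Suc.prems(2)[of "x # xs" 0 l] that \<open>x \<in> col p\<close> \<open>transversal col (Suc p) xs\<close>
        \<open>length xs = m\<close> by simp
  qed fact
  have 2: "(\<Sum>x\<in>col p. tsum col m (Suc p)
      (\<lambda>xs. pairing n (K (x # xs)) (g (Fix (b p) # map Edge xs)))) = 0"
    unfolding tsum_sum
  proof (rule tsum_eq_0)
    fix xs assume "transversal col (Suc p) xs" "length xs = m"
    then have "(\<Sum>x\<in>col p. K (x # xs) l) = 0" if "\<forall>w\<in>set l. \<forall>p. w p \<in> col p" for l
      using Suc.prems(3)[of "b p # xs" 0 l] that base[of p] by simp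
    then have "pairing n (\<lambda>l. \<Sum>x\<in>col p. K (x # xs) l) z = 0" for z
      by (rule pairing_eq_0)
    then show "(\<Sum>x\<in>col p. pairing n (K (x # xs)) (g (Fix (b p) # map Edge xs))) = 0"
      by (simp only: pairing_sum)
  qed
  have 3: "tsum col m (Suc p) (\<lambda>xs. cube_bd b (Suc p)
      (\<lambda>e. pairing n (K (x # xs)) (g (Edge x # e))) (map Edge xs)) = 0" if "x \<in> col p" for x
  proof (rule Suc.IH)
    show "carried m (Suc p) (\<lambda>e. g (Edge x # e))"
      using carried_Cons[OF Suc.prems(1), of "Edge x"] that by simp
    show "K (x # xs) l = 0" if "transversal col (Suc p) xs" "length xs = m" "q < m"
      "\<forall>w\<in>set l. \<forall>p. w p \<noteq> xs ! q" for xs l q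
      using Suc.prems(2)[of "x # xs" "Suc q" l] that \<open>x \<in> col p\<close> by simp
    show "(\<Sum>y\<in>col (Suc p + q). K (x # xs[q := y]) l) = 0"
      if "transversal col (Suc p) xs" "length xs = m" "q < m"
      "\<forall>w\<in>set l. \<forall>p. w p \<in> col p" for xs l q
      using Suc.prems(3)[of "x # xs" "Suc q" l] that \<open>x \<in> col p\<close> by simp
  qed
  have "tsum col m (Suc p) (\<lambda>xs. pairing n (K (x # xs)) (g (Fix x # map Edge xs))) = 0"
    if "x \<in> col p" for x
    using 1 that by (intro tsum_eq_0)
  with 2 3 show ?case
    by (simp add: tsum_diff sum_subtractf sum_negf)
qed simp

text \<open>
  \<open>o0\<close> plays the part of the empty face: vertices of the cubes are mapped to chains of
  augmentation \<open>1\<close>.  Cubes with all sides free are left out, as they need not have an image.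
\<close>

definition cubical_chain_map :: "'f \<Rightarrow> nat \<Rightarrow> nat \<Rightarrow> ('i side list \<Rightarrow> 'f \<Rightarrow> 'k) \<Rightarrow> bool" where
  "cubical_chain_map o0 n p g \<longleftrightarrow> (\<forall>e G. length e = n \<longrightarrow> transversal col p (map side_label e) \<longrightarrow>
     fixed e \<noteq> {} \<longrightarrow> G \<in> X \<longrightarrow>
     (\<Sum>F\<in>X. inc F G * g e F) =
       (if cube_dim e = 0 then of_bool (G = o0) else cube_bd b p (\<lambda>e'. g e' G) e))"

lemma pairing_cube_bd:
  "pairing n f (\<lambda>F. cube_bd b p (\<lambda>e. g e F) e) = cube_bd b p (\<lambda>e. pairing n f (g e)) e"
  unfolding pairing_def by (simp add: cube_bd_linear)

lemma pairing_cong: "(\<And>F. F \<in> X \<Longrightarrow> z F = z' F) \<Longrightarrow> pairing n f z = pairing n f z'"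
  by (simp add: pairing_def)

lemma cubical_chain_map_Cons:
  assumes "cubical_chain_map o0 (Suc n) p g"
  shows "cubical_chain_map o0 n (Suc p) (\<lambda>e. g (Fix (b p) # e))"
  unfolding cubical_chain_map_def
proof (intro allI impI)
  fix e G
  assume "length e = n" "transversal col (Suc p) (map side_label e)" "fixed e \<noteq> {}" "G \<in> X"
  then show "(\<Sum>F\<in>X. inc F G * g (Fix (b p) # e) F) =
      (if cube_dim e = 0 then of_bool (G = o0)
       else cube_bd b (Suc p) (\<lambda>e'. g (Fix (b p) # e') G) e)"
    using assms[unfolded cubical_chain_map_def, rule_format, of "Fix (b p) # e" G] base[of p]
    by simp
qed

text \<open>
  Only the values at tuples of points of the product of the color classes matter.
\<close>

lemma pairing_cong_col:
  assumes "\<And>l. \<forall>w\<in>set l. \<forall>p. w p \<in> col p \<Longrightarrow> f l = f' l"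
  shows "pairing n f z = pairing n f' z"
proof -
  have "pairing n (\<lambda>l. f l - f' l) z = 0"
    using assms by (intro pairing_eq_0) simp
  then show ?thesis
    by (simp add: pairing_def pull_diff right_diff_distrib sum_subtractf)
qed

text \<open>
  What remains of the boundary are the facets that fix the first coordinate at the base point.
  The factor \<open>[x]\<close> in the first color sums to \<open>1\<close>, what is left of the cochain is a
  coboundary, and Stokes's formula moves it to the boundary of the facet.
\<close>

lemma top_evaluation_step:
  assumes "carried (Suc m) p g" "cubical_chain_map o0 (Suc m) p g"
  shows "tsum col (Suc m) p (\<lambda>xs. cube_bd b p
      (\<lambda>e. pairing (Suc m) (rainbow_cochain p xs) (g e)) (map Edge xs)) =
    - tsum col m (Suc p) (\<lambda>xs. pairing m (rainbow_cochain (Suc p) xs)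
        (\<lambda>G. if m = 0 then of_bool (G = o0)
             else cube_bd b (Suc p) (\<lambda>e. g (Fix (b p) # e) G) (map Edge xs)))"
proof -
  let ?P = "\<lambda>x xs. pairing (Suc m) (rainbow_cochain p (x # xs))"
  have 1: "?P x xs (g (Fix x # map Edge xs)) = 0"
    if "x \<in> col p" "transversal col (Suc p) xs" "length xs = m" for x xs
  proof (rule pairing_avoid_eq_0)
    show "F \<in> C x" if "F \<in> X" "g (Fix x # map Edge xs) F \<noteq> 0" for F
      using that assms(1) \<open>x \<in> col p\<close> \<open>transversal col (Suc p) xs\<close> \<open>length xs = m\<close>
      unfolding carried_def
      by (auto simp: fixed_def comp_def dest!: spec[of _ "Fix x # map Edge xs"])
    show "rainbow_cochain p (x # xs) l = (0 :: 'k)" if "\<forall>w\<in>set l. \<forall>p. w p \<noteq> x" for l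
      using that by (cases l) (simp_all del: cobd.simps)
  qed fact
  have 2: "tsum col m (Suc p) (\<lambda>xs. cube_bd b (Suc p)
      (\<lambda>e. ?P x xs (g (Edge x # e))) (map Edge xs)) = 0" if "x \<in> col p" for x
  proof (rule boundary_terms_cancel)
    show "carried m (Suc p) (\<lambda>e. g (Edge x # e))"
      using carried_Cons[OF assms(1), of "Edge x"] that by simp
    show "rainbow_cochain p (x # xs) l = (0 :: 'k)" if "length xs = m" "q < m"
      "\<forall>w\<in>set l. \<forall>p. w p \<noteq> xs ! q" for xs q and l :: "(nat \<Rightarrow> 'i) list"
      proof -
      have "cobd (rainbow_cochain (Suc p) xs) l = (0 :: 'k)"
        using that by (intro cobd_rainbow_avoid[of q]) auto
      then show ?thesis
        by simp
    qed
    show "(\<Sum>y\<in>col (Suc p + q). rainbow_cochain p (x # xs[q := y]) l) = (0 :: 'k)"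
      if "length xs = m" "q < m" "\<forall>w\<in>set l. \<forall>p. w p \<in> col p"
      for xs q and l :: "(nat \<Rightarrow> 'i) list"
    proof -
      have "(\<Sum>y\<in>col (Suc p + q). cobd (rainbow_cochain (Suc p) (xs[q := y])) l) = (0 :: 'k)"
        using that finite_col by (intro cobd_rainbow_sum) auto
      then show ?thesis
        by (cases "l = []") (simp_all flip: sum_distrib_left)
    qed
  qed
  have 3: "(\<Sum>x\<in>col p. ?P x xs (g (Fix (b p) # map Edge xs))) =
      pairing m (rainbow_cochain (Suc p) xs) (\<lambda>G. if m = 0 then of_bool (G = o0)
             else cube_bd b (Suc p) (\<lambda>e. g (Fix (b p) # e) G) (map Edge xs))"
    if "transversal col (Suc p) xs" "length xs = m" for xs
  proof -
    let ?e = "Fix (b p) # map Edge xs"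
    have "(\<Sum>x\<in>col p. ?P x xs (g ?e)) =
        pairing (Suc m) (\<lambda>l. \<Sum>x\<in>col p. rainbow_cochain p (x # xs) l) (g ?e)"
      by (simp only: pairing_sum)
    also have "\<dots> = pairing (Suc m) (cobd (rainbow_cochain (Suc p) xs)) (g ?e)"
    proof (rule pairing_cong_col)
      fix l :: "(nat \<Rightarrow> 'i) list" assume "\<forall>w\<in>set l. \<forall>p. w p \<in> col p"
      then have "(\<Sum>x\<in>col p. of_bool (hd l p = x)) = (1 :: 'k)" if "l \<noteq> []"
        using that finite_col[of p] by (simp add: of_bool_def)
      then show "(\<Sum>x\<in>col p. rainbow_cochain p (x # xs) l) =
          (cobd (rainbow_cochain (Suc p) xs) l :: 'k)"
        by (cases "l = []") (simp_all flip: sum_distrib_right)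
    qed
    also have "\<dots> = pairing m (rainbow_cochain (Suc p) xs) (\<lambda>G. \<Sum>F\<in>X. inc F G * g ?e F)"
      by (rule pairing_boundary[symmetric])
    also have "\<dots> = pairing m (rainbow_cochain (Suc p) xs) (\<lambda>G. if m = 0 then of_bool (G = o0)
             else cube_bd b (Suc p) (\<lambda>e. g (Fix (b p) # e) G) (map Edge xs))"
      using assms(2)[unfolded cubical_chain_map_def, rule_format, of ?e] base[of p] that
      by (intro pairing_cong) (simp_all add: comp_def cube_dim_Edge)
    finally show ?thesis .
  qed
  have 4: "tsum col m (Suc p) (\<lambda>xs. ?P x xs (g (Fix x # map Edge xs))) = 0" if "x \<in> col p" for x
    using 1 that by (intro tsum_eq_0)
  have "tsum col (Suc m) p (\<lambda>xs. cube_bd b p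
      (\<lambda>e. pairing (Suc m) (rainbow_cochain p xs) (g e)) (map Edge xs)) =
      (\<Sum>x\<in>col p. tsum col m (Suc p) (\<lambda>xs. ?P x xs (g (Fix x # map Edge xs))) -
        tsum col m (Suc p) (\<lambda>xs. ?P x xs (g (Fix (b p) # map Edge xs))) -
        tsum col m (Suc p) (\<lambda>xs. cube_bd b (Suc p)
          (\<lambda>e. ?P x xs (g (Edge x # e))) (map Edge xs)))"
    by (simp only: tsum.simps list.map cube_bd.simps side.case tsum_diff)
  also have "\<dots> = (\<Sum>x\<in>col p. - tsum col m (Suc p) (\<lambda>xs. ?P x xs (g (Fix (b p) # map Edge xs))))"
    by (intro sum.cong refl) (simp only: 2 4 diff_0 diff_0_right)
  also have "\<dots> = - tsum col m (Suc p)
      (\<lambda>xs. \<Sum>x\<in>col p. ?P x xs (g (Fix (b p) # map Edge xs)))"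
    by (simp only: sum_negf tsum_sum)
  also have "\<dots> = - tsum col m (Suc p) (\<lambda>xs. pairing m (rainbow_cochain (Suc p) xs)
        (\<lambda>G. if m = 0 then of_bool (G = o0)
             else cube_bd b (Suc p) (\<lambda>e. g (Fix (b p) # e) G) (map Edge xs)))"
    by (intro arg_cong[where f = uminus] tsum_cong 3)
  finally show ?thesis .
qed

text \<open>
  Each step removes the first color and contributes a sign; the last one gives the
  augmentation of the image of a vertex.
\<close>

lemma top_evaluation:
  assumes "finite X" "o0 \<in> X" "carried (Suc m) p g" "cubical_chain_map o0 (Suc m) p g"
  shows "tsum col (Suc m) p (\<lambda>xs. cube_bd b p
      (\<lambda>e. pairing (Suc m) (rainbow_cochain p xs) (g e)) (map Edge xs)) = (- 1) ^ Suc m"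
  using assms(3,4)
proof (induction m arbitrary: p g)
  case 0
  have "pairing 0 (rainbow_cochain (Suc p) []) (\<lambda>G. of_bool (G = o0)) = 1"
    using assms(1,2) by (simp add: pairing_def of_bool_def)
  then show ?case
    unfolding top_evaluation_step[OF 0] by simp
next
  case (Suc m)
  show ?case
    unfolding top_evaluation_step[OF Suc.prems]
    using Suc.IH[OF carried_Cons[OF Suc.prems(1)] cubical_chain_map_Cons[OF Suc.prems(2)]] base
    by (simp add: pairing_cube_bd del: tsum.simps rainbow_cochain.simps)
qed

end

section \<open>Cubes in the complex\<close>

lemma incidence_nonzero:
  assumes "incidence F G \<noteq> 0"
  shows "G face_of F" "F \<noteq> {}"
proof -
  have *: "G face_of F" "aff_dim G = aff_dim F - 1"
    using assms by (auto simp: incidence_def split: if_splits)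
  then show "G face_of F" "F \<noteq> {}"
    using aff_dim_geq[of G] by auto
qed

lemma cell_boundary_subcomplex:
  assumes "finite X" "Y \<subseteq> X" "z \<in> cell_chains Y j"
  shows "cell_boundary Y z = cell_boundary X z"
proof
  show "cell_boundary Y z G = cell_boundary X z G" for G
    unfolding cell_boundary_def using assms
    by (intro sum.mono_neutral_left) (auto simp: cell_chains_def)
qed

text \<open>
  The chain that the image of \<open>e\<close> has to bound; for a vertex it is the empty face, the
  generator in degree \<open>-1\<close>.
\<close>

definition attaching_chain ::
    "(nat \<Rightarrow> 'i) \<Rightarrow> ('i side list \<Rightarrow> 'a set \<Rightarrow> 'k::field) \<Rightarrow> 'i side list \<Rightarrow> 'a set \<Rightarrow> 'k" where
  "attaching_chain b g e =
     (if cube_dim e = 0 then (\<lambda>G. of_bool (G = {})) else (\<lambda>G. cube_bd b 0 (\<lambda>e'. g e' G) e))"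

definition cube_filling ::
    "'a::euclidean_space set set \<Rightarrow> ('i set \<Rightarrow> 'a set set) \<Rightarrow> (nat \<Rightarrow> 'i) \<Rightarrow>
     ('i side list \<Rightarrow> 'a set \<Rightarrow> 'k::field) \<Rightarrow> 'i side list \<Rightarrow> bool" where
  "cube_filling X Y b g e \<longleftrightarrow> g e \<in> cell_chains (Y (fixed e)) (int (cube_dim e)) \<and>
     cell_boundary X (g e) = attaching_chain b g e"

lemma attaching_chain_cong:
  assumes "\<And>e'. e' \<in> cube_faces b 0 e \<Longrightarrow> g e' = h e'"
  shows "attaching_chain b g e = attaching_chain b h e"
  unfolding attaching_chain_def using assms by (auto intro!: ext cube_bd_cong)

lemma attaching_chain_in_chains:
  assumes "\<And>e'. e' \<in> cube_faces b 0 e \<Longrightarrow> cube_filling X Y b g e'"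
    and "\<And>A A'. A \<subseteq> A' \<Longrightarrow> Y A' \<subseteq> Y A" and "{} \<in> Y (fixed e)"
  shows "attaching_chain b g e \<in> cell_chains (Y (fixed e)) (int (cube_dim e) - 1)"
proof -
  have "F \<in> Y (fixed e) \<and> aff_dim F = int (cube_dim e) - 1"
    if F: "cube_bd b 0 (\<lambda>e'. g e' F) e \<noteq> 0" for F
  proof -
    obtain e' where e': "e' \<in> cube_faces b 0 e" "g e' F \<noteq> 0"
      using F cube_bd_cong[of b 0 e "\<lambda>e'. g e' F" "\<lambda>_. 0"] cube_bd_const[of b 0 0 e] by metis
    then have "F \<in> Y (fixed e')" "aff_dim F = int (cube_dim e')"
      using assms(1)[of e'] by (auto simp: cube_filling_def cell_chains_def)
    then show ?thesis
      using assms(2)[OF cube_faces_fixed] cube_faces_dim e'(1) by fastforce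
  qed
  then show ?thesis
    using assms(3) by (auto simp: attaching_chain_def cell_chains_def)
qed

lemma cell_boundary_attaching_chain:
  fixes g :: "'i side list \<Rightarrow> 'a::euclidean_space set \<Rightarrow> 'k::field"
  assumes "\<And>e'. e' \<in> cube_faces b 0 e \<Longrightarrow> cube_filling X Y b g e'"
  shows "cell_boundary X (attaching_chain b g e) = (\<lambda>_. 0)"
proof
  fix G
  show "cell_boundary X (attaching_chain b g e) G = 0"
  proof (cases "cube_dim e = 0")
    case True
    have "incidence {} G = 0"
      using incidence_nonzero(2) by blast
    then show ?thesis
      using True by (auto simp: cell_boundary_def attaching_chain_def intro!: sum.neutral)
  next
    case False
    then have "cell_boundary X (attaching_chain b g e) G =
        cube_bd b 0 (\<lambda>e'. cell_boundary X (g e') G) e"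
      using cube_bd_linear[of b 0 "\<lambda>F e'. g e' F" "\<lambda>F. of_int (incidence F G)" X e]
      by (simp add: attaching_chain_def cell_boundary_def mult.commute)
    also have "\<dots> = cube_bd b 0 (\<lambda>e'. attaching_chain b g e' G) e"
      using assms by (intro cube_bd_cong) (simp add: cube_filling_def)
    also have "\<dots> = 0"
    proof (cases "cube_dim e = 1")
      case True
      then have "cube_bd b 0 (\<lambda>e'. attaching_chain b g e' G) e =
          cube_bd b 0 (\<lambda>_. of_bool (G = {}) :: 'k) e"
        using cube_faces_dim by (intro cube_bd_cong) (fastforce simp: attaching_chain_def)
      then show ?thesis
        by (simp add: cube_bd_const)
    next
      case ne1: False
      have "cube_bd b 0 (\<lambda>e'. attaching_chain b g e' G) e =
          cube_bd b 0 (cube_bd b 0 (\<lambda>e'. g e' G)) e"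
      proof (rule cube_bd_cong)
        fix e' assume "e' \<in> cube_faces b 0 e"
        then have "cube_dim e' \<noteq> 0"
          using cube_faces_dim ne1 by fastforce
        then show "attaching_chain b g e' G = cube_bd b 0 (\<lambda>e'. g e' G) e'"
          by (simp add: attaching_chain_def)
      qed
      then show ?thesis
        by (simp add: cube_bd_cube_bd)
    qed
    finally show ?thesis .
  qed
qed

text \<open>
  The method of acyclic carriers: along increasing dimension, the boundary of a cube is mapped
  to a cycle in the complex assigned to its fixed coordinates, and this cycle bounds.
\<close>

lemma cube_filling_exists:
  fixes X :: "'a::euclidean_space set set" and Y :: "'i set \<Rightarrow> 'a set set"
  assumes base: "\<And>p. b p \<in> col p"
    and antimono: "\<And>A A'. A \<subseteq> A' \<Longrightarrow> Y A' \<subseteq> Y A"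
    and empty: "\<And>e. length e = n \<Longrightarrow> transversal col 0 (map side_label e) \<Longrightarrow> {} \<in> Y (fixed e)"
    and acyclic: "\<And>e j (z :: 'a set \<Rightarrow> 'k::field). length e = n \<Longrightarrow>
      transversal col 0 (map side_label e) \<Longrightarrow>
      z \<in> cell_chains (Y (fixed e)) j \<Longrightarrow> cell_boundary X z = (\<lambda>_. 0) \<Longrightarrow>
      \<exists>y\<in>cell_chains (Y (fixed e)) (j + 1). cell_boundary X y = z"
  shows "\<exists>g :: 'i side list \<Rightarrow> 'a set \<Rightarrow> 'k. \<forall>e. length e = n \<longrightarrow>
    transversal col 0 (map side_label e) \<longrightarrow> cube_dim e < k \<longrightarrow> cube_filling X Y b g e"
proof (induction k)
  case (Suc k)
  define V where "V = {e. length e = n \<and> transversal col 0 (map side_label e)}"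
  have V_faces: "e' \<in> V" if "e' \<in> cube_faces b 0 e" "e \<in> V" for e e'
    using that cube_faces_length[OF that(1)] cube_faces_transversal[OF base that(1)]
    by (simp add: V_def)
  obtain g :: "'i side list \<Rightarrow> 'a set \<Rightarrow> 'k"
    where g: "\<And>e. e \<in> V \<Longrightarrow> cube_dim e < k \<Longrightarrow> cube_filling X Y b g e"
    using Suc.IH unfolding V_def by auto
  have "\<exists>y\<in>cell_chains (Y (fixed e)) (int k). cell_boundary X y = attaching_chain b g e"
    if e: "e \<in> V" "cube_dim e = k" for e
  proof -
    have *: "cube_filling X Y b g e'" if "e' \<in> cube_faces b 0 e" for e'
      using g V_faces cube_faces_dim that e by fastforce
    have "attaching_chain b g e \<in> cell_chains (Y (fixed e)) (int k - 1)"
      using attaching_chain_in_chains[of b e X Y g, OF * antimono] e empty by (simp add: V_def)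
    moreover have "cell_boundary X (attaching_chain b g e) = (\<lambda>_. 0)"
      using * by (rule cell_boundary_attaching_chain)
    ultimately show ?thesis
      using acyclic[of e "attaching_chain b g e" "int k - 1"] e by (simp add: V_def)
  qed
  then obtain h where h: "\<And>e. e \<in> V \<Longrightarrow> cube_dim e = k \<Longrightarrow>
      h e \<in> cell_chains (Y (fixed e)) (int k) \<and> cell_boundary X (h e) = attaching_chain b g e"
    by metis
  define g' where "g' e = (if cube_dim e = k then h e else g e)" for e
  have "cube_filling X Y b g' e" if e: "e \<in> V" "cube_dim e < Suc k" for e
  proof -
    have "attaching_chain b g' e = attaching_chain b g e"
      using cube_faces_dim e(2) by (intro attaching_chain_cong) (fastforce simp: g'_def)
    then show ?thesis
      using e h[of e] g[of e] by (auto simp: cube_filling_def g'_def)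
  qed
  then show ?case
    unfolding V_def by blast
qed simp

section \<open>Monomials in the Stanley--Reisner ideal\<close>

lemma keys_exponent_add: "Poly_Mapping.keys (a + b) = Poly_Mapping.keys a \<union> Poly_Mapping.keys b"
  for a b :: "'i \<Rightarrow>\<^sub>0 nat"
  by (auto simp: in_keys_iff lookup_add)

lemma polynomial_ring_simps [simp]:
  "f \<in> carrier (polynomial_ring B) \<longleftrightarrow> (\<forall>m\<in>Poly_Mapping.keys f. Poly_Mapping.keys m \<subseteq> B)"
  "f \<otimes>\<^bsub>polynomial_ring B\<^esub> g = f * g" "f \<oplus>\<^bsub>polynomial_ring B\<^esub> g = f + g"
  "\<one>\<^bsub>polynomial_ring B\<^esub> = 1" "\<zero>\<^bsub>polynomial_ring B\<^esub> = 0"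
  by (simp_all add: polynomial_ring_def)

lemma ring_polynomial_ring: "ring (polynomial_ring B :: (('i \<Rightarrow>\<^sub>0 nat) \<Rightarrow>\<^sub>0 'k::field) ring)"
proof -
  let ?R = "polynomial_ring B :: (('i \<Rightarrow>\<^sub>0 nat) \<Rightarrow>\<^sub>0 'k) ring"
  have add: "f + g \<in> carrier ?R" if "f \<in> carrier ?R" "g \<in> carrier ?R" for f g
    using that keys_add[of f g] by auto
  have mult: "f * g \<in> carrier ?R" if "f \<in> carrier ?R" "g \<in> carrier ?R" for f g
  proof -
    have "Poly_Mapping.keys m \<subseteq> B" if "m \<in> Poly_Mapping.keys (f * g)" for m
    proof -
      obtain a c where "m = a + c" "a \<in> Poly_Mapping.keys f" "c \<in> Poly_Mapping.keys g"
        using \<open>m \<in> _\<close> keys_mult[of f g] by auto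
      then show ?thesis
        using \<open>f \<in> _\<close> \<open>g \<in> _\<close> by (simp add: keys_exponent_add)
    qed
    then show ?thesis
      by simp
  qed
  have minus: "\<exists>g\<in>carrier ?R. g + f = 0" if "f \<in> carrier ?R" for f
    using that by (intro bexI[of _ "- f"]) simp_all
  show ?thesis
  proof (intro ringI abelian_groupI monoidI)
    show "f \<oplus>\<^bsub>?R\<^esub> g \<in> carrier ?R" if "f \<in> carrier ?R" "g \<in> carrier ?R" for f g
      using add[OF that] by (simp only: polynomial_ring_simps)
    show "f \<otimes>\<^bsub>?R\<^esub> g \<in> carrier ?R" if "f \<in> carrier ?R" "g \<in> carrier ?R" for f g
      using mult[OF that] by (simp only: polynomial_ring_simps)
    show "\<exists>g\<in>carrier ?R. g \<oplus>\<^bsub>?R\<^esub> f = \<zero>\<^bsub>?R\<^esub>" if "f \<in> carrier ?R" for f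
      using minus[OF that] by (simp only: polynomial_ring_simps)
  qed (simp_all add: algebra_simps)
qed

definition squarefree_exponent :: "'i set \<Rightarrow> 'i \<Rightarrow>\<^sub>0 nat" where
  "squarefree_exponent \<tau> = (\<Sum>i\<in>\<tau>. Poly_Mapping.single i 1)"

lemma lookup_squarefree_exponent:
  "finite \<tau> \<Longrightarrow> Poly_Mapping.lookup (squarefree_exponent \<tau>) i = of_bool (i \<in> \<tau>)"
  by (simp add: squarefree_exponent_def lookup_sum lookup_single when_def of_bool_def)

lemma keys_squarefree_exponent: "finite \<tau> \<Longrightarrow> Poly_Mapping.keys (squarefree_exponent \<tau>) = \<tau>"
  by (auto simp: in_keys_iff lookup_squarefree_exponent)

lemma prod_var_poly: "(\<Prod>i\<in>\<tau>. var_poly i) = monom_poly (squarefree_exponent \<tau>)"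
proof (induction \<tau> rule: infinite_finite_induct)
  case (insert i \<tau>)
  then show ?case 
    by (simp add: squarefree_exponent_def monom_poly_def var_poly_def mult_single del: single_one)
qed (simp_all add: squarefree_exponent_def monom_poly_def)

lemma nonface_imp_monom_poly_in_ideal:
  assumes "\<tau> \<subseteq> B" "\<tau> \<notin> N" 
  shows "monom_poly (squarefree_exponent \<tau>) \<in> stanley_reisner_ideal B N"
proof -
  have "monom_poly (squarefree_exponent \<tau>) \<in> {\<Prod>i\<in>\<tau>. var_poly i |\<tau>. \<tau> \<subseteq> B \<and> \<tau> \<notin> N}"
    unfolding prod_var_poly using assms by blast
  then show ?thesis
    unfolding stanley_reisner_ideal_def genideal_def by blast
qed

text \<open>
  The polynomials all of whose monomials have a nonface in their support form an ideal that
  contains the generators.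
\<close>

lemma monom_poly_in_ideal_imp_nonface:
  assumes "finite B"
    and "monom_poly m \<in> (stanley_reisner_ideal B N :: (('i \<Rightarrow>\<^sub>0 nat) \<Rightarrow>\<^sub>0 'k::field) set)"
  shows "\<exists>\<tau>\<subseteq>Poly_Mapping.keys m. \<tau> \<subseteq> B \<and> \<tau> \<notin> N"
proof -
  let ?R = "polynomial_ring B :: (('i \<Rightarrow>\<^sub>0 nat) \<Rightarrow>\<^sub>0 'k) ring"
  interpret ring ?R
    by (rule ring_polynomial_ring)
  define P :: "('i \<Rightarrow>\<^sub>0 nat) \<Rightarrow> bool"
    where "P m \<longleftrightarrow> (\<exists>\<tau>\<subseteq>Poly_Mapping.keys m. \<tau> \<subseteq> B \<and> \<tau> \<notin> N)" for m
  define J where "J = {f \<in> carrier ?R. \<forall>m\<in>Poly_Mapping.keys f. P m}"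
  have J_add: "f + g \<in> J" if "f \<in> J" "g \<in> J" for f g
    using that keys_add[of f g] unfolding J_def mem_Collect_eq polynomial_ring_simps by blast
  have J_mult: "g * f \<in> J" if "f \<in> J" "g \<in> carrier ?R" for f g
  proof -
    have "P m" if m: "m \<in> Poly_Mapping.keys (g * f)" for m
    proof -
      obtain a c where ac: "m = a + c" "c \<in> Poly_Mapping.keys f"
        using m keys_mult[of g f] by auto
      then have "P c"
        using \<open>f \<in> J\<close> by (simp add: J_def)
      then show ?thesis
        unfolding P_def ac(1) keys_exponent_add by blast
    qed
    moreover have "g * f \<in> carrier ?R"
      using m_closed[of g f] that unfolding J_def by simp
    ultimately show ?thesis
      unfolding J_def by simp
  qed
  have "ideal J ?R"
  proof (rule idealI)
    show "ring ?R"
      by (rule ring_polynomial_ring)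
    show "subgroup J (add_monoid ?R)"
    proof
      show "J \<subseteq> carrier (add_monoid ?R)"
        by (auto simp: J_def)
      show "\<one>\<^bsub>add_monoid ?R\<^esub> \<in> J"
        by (simp add: J_def)
      show "f \<otimes>\<^bsub>add_monoid ?R\<^esub> g \<in> J" if "f \<in> J" "g \<in> J" for f g
        using J_add[OF that] by simp
      show "inv\<^bsub>add_monoid ?R\<^esub> f \<in> J" if "f \<in> J" for f
      proof -
        have "\<ominus>\<^bsub>?R\<^esub> f = - f"
          using that by (intro minus_equality) (simp_all add: J_def)
        then show ?thesis
          using that by (simp add: a_inv_def J_def)
      qed
    qed
    show "g \<otimes>\<^bsub>?R\<^esub> f \<in> J" "f \<otimes>\<^bsub>?R\<^esub> g \<in> J" if "f \<in> J" "g \<in> carrier ?R" for f g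
      using J_mult[OF that] by (simp_all add: mult.commute)
  qed
  moreover have "{\<Prod>i\<in>\<tau>. var_poly i |\<tau>. \<tau> \<subseteq> B \<and> \<tau> \<notin> N} \<subseteq> J"
  proof clarify
    fix \<tau> assume "\<tau> \<subseteq> B" "\<tau> \<notin> N"
    moreover from this have "Poly_Mapping.keys (squarefree_exponent \<tau>) = \<tau>"
      using assms(1) by (intro keys_squarefree_exponent) (rule finite_subset)
    ultimately have "P (squarefree_exponent \<tau>)" "Poly_Mapping.keys (squarefree_exponent \<tau>) \<subseteq> B"
      unfolding P_def by auto
    then show "(\<Prod>i\<in>\<tau>. var_poly i) \<in> J"
      by (simp add: prod_var_poly monom_poly_def J_def)
  qed
  ultimately have "stanley_reisner_ideal B N \<subseteq> J"
    unfolding stanley_reisner_ideal_def genideal_def by (intro Inter_lower) simp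
  then have "monom_poly m \<in> J"
    using assms(2) by (rule subsetD)
  then show ?thesis
    by (simp add: J_def P_def monom_poly_def)
qed

section \<open>The colorful theorem\<close>

lemma nerve_subset: "A \<in> nerve X B C \<Longrightarrow> A' \<subseteq> A \<Longrightarrow> A' \<in> nerve X B C"
  unfolding nerve_def nonempty_complex_def subcomplex_Inter_def by blast

lemma face_in_induced_subcomplex:
  assumes "polyhedral_complex X" "F \<in> induced_subcomplex X V" "G face_of F"
  shows "G \<in> induced_subcomplex X V"
  using assms extreme_point_of_face[OF assms(3)]
  unfolding polyhedral_complex_def induced_subcomplex_def by blast

theorem theorem3p5:
  fixes X :: "'a::euclidean_space set set"
    and d :: nat
    and B :: "'i set"
    and Bc :: "nat \<Rightarrow> 'i set"
    and C :: "'i \<Rightarrow> 'a set set"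
    and I\<^sub>N :: "(('i \<Rightarrow>\<^sub>0 nat) \<Rightarrow>\<^sub>0 'k::field) set"
  assumes "polyhedral_complex X"
    and "complex_dim X = int d"
    and "reduced_homology_vanishes TYPE('k) X (int d)"
    and "finite B"
    and "B = (\<Union>p\<in>{1..d + 1}. Bc p)"
    and "disjoint_family_on Bc {1..d + 1}"
    and "\<forall>i\<in>B. \<exists>V \<subseteq> vertices X. C i = induced_subcomplex X V"
    and "\<forall>A \<subseteq> B. \<not> nonempty_complex (subcomplex_Inter X C A) \<or>
                   acyclic_over TYPE('k) (subcomplex_Inter X C A)"
    and "I\<^sub>N = stanley_reisner_ideal B (nerve X B C)"
    and "\<forall>p\<in>{1..d + 1}. \<exists>m. squarefree_monomial B m \<and> monom_poly m \<in> I\<^sub>N \<and>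
                             has_pure_color (d + 1) Bc m p"
  shows "\<exists>m. squarefree_monomial B m \<and> monom_poly m \<in> I\<^sub>N \<and>
             has_color_vector (d + 1) Bc m (\<lambda>q. \<Sum>p=1..d + 1. unit_vector p q)"
proof (rule ccontr)
  assume no_rainbow: "\<not> ?thesis"
  let ?N = "nerve X B C" and ?n = "d + 1"
  let ?inc = "\<lambda>F G. of_int (incidence F G) :: 'k"
  \<comment> \<open>The colors are repeated periodically, starting with \<open>Bc 1\<close> at \<open>0\<close>, so that every natural
     number is a color and no range conditions are needed.\<close>
  define col where "col p = Bc (Suc (p mod ?n))" for p
  have fin: "finite X"
    using assms(1) by (simp add: polyhedral_complex_def)
  have face: "G \<in> X" if "F \<in> X" "G face_of F" for F G
    using assms(1) that unfolding polyhedral_complex_def by blast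
  have dim_le: "aff_dim F \<le> int d" if "F \<in> X" for F
    using that fin assms(2) Max_ge[of "insert (-1) (aff_dim ` X)" "aff_dim F"]
    by (simp add: complex_dim_def)
  have "Max (insert (-1) (aff_dim ` X)) \<in> insert (-1) (aff_dim ` X)"
    using fin by (intro Max_in) auto
  then obtain F0 where F0: "F0 \<in> X" "aff_dim F0 = int d"
    using assms(2) unfolding complex_dim_def by auto
  have F0_ne: "F0 \<noteq> {}"
    using F0(2) by auto
  have empty_X: "{} \<in> X"
    using face[OF F0(1)] by simp
  have col_B: "col p \<subseteq> B" for p
    unfolding col_def using assms(5) by (auto simp: Suc_le_eq)
  have induced: "\<exists>V. C i = induced_subcomplex X V" if "i \<in> B" for i
    using assms(7) that by blast

  have color_nonface: "col p \<notin> ?N" for p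
  proof
    assume in_N: "col p \<in> ?N"
    define r where "r = Suc (p mod ?n)"
    have r: "r \<in> {1..?n}"
      by (simp add: r_def Suc_le_eq)
    obtain m where m: "squarefree_monomial B m" "monom_poly m \<in> I\<^sub>N" "has_pure_color ?n Bc m r"
      using assms(10) r by blast
    obtain \<tau> where \<tau>: "\<tau> \<subseteq> Poly_Mapping.keys m" "\<tau> \<subseteq> B" "\<tau> \<notin> ?N"
      using monom_poly_in_ideal_imp_nonface[OF assms(4), of m ?N] m(2) assms(9) by auto
    have "\<tau> \<subseteq> Bc r"
    proof
      fix i assume i: "i \<in> \<tau>"
      then obtain q where q: "q \<in> {1..?n}" "i \<in> Bc q"
        using \<tau>(2) assms(5) by auto
      have "finite (Bc q)"
        using assms(4,5) q(1) by (auto intro: finite_subset)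
      then have "card {i \<in> Bc q. i \<in> Poly_Mapping.keys m} \<noteq> 0"
        using q(2) i \<tau>(1) by (auto simp: card_eq_0_iff)
      moreover obtain c where "card {i \<in> Bc q. i \<in> Poly_Mapping.keys m} = c * unit_vector r q"
        using m(3) q(1) unfolding has_pure_color_def has_color_vector_def by blast
      ultimately have "q = r"
        by (simp add: unit_vector_def split: if_splits)
      then show "i \<in> Bc r"
        using q(2) by simp
    qed
    then show False
      using nerve_subset[OF in_N] \<tau>(3) by (auto simp: col_def r_def)
  qed
  then have avoid: "\<exists>i\<in>col p. F \<notin> C i" if "F \<in> X" "F \<noteq> {}" for F p
    using that col_B[of p]
    unfolding nerve_def nonempty_complex_def subcomplex_Inter_def by blast
  define pt where "pt F p = (SOME i. i \<in> col p \<and> F \<notin> C i)" for F p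
  have pt: "pt F p \<in> col p \<and> F \<notin> C (pt F p)" if "F \<in> X" "F \<noteq> {}" for F p
    unfolding pt_def by (rule someI_ex) (use avoid that in blast)
  \<comment> \<open>Any point of the product of the color classes serves as base point.\<close>
  define b where "b = pt F0"
  have b: "b p \<in> col p" for p
    using pt F0(1) F0_ne by (simp add: b_def)

  have rainbow_face: "set xs \<in> ?N" if xs: "transversal col 0 xs" "length xs = ?n" for xs
  proof (rule ccontr)
    assume nonface: "set xs \<notin> ?N"
    have nth: "xs ! q \<in> Bc (Suc q)" if "q < ?n" for q
      using transversal_nth[OF xs(1), of q] xs(2) that by (simp add: col_def)
    have sub: "set xs \<subseteq> B"
      using nth xs(2) assms(5) by (fastforce simp: in_set_conv_nth)
    have "{i \<in> Bc p. i \<in> set xs} = {xs ! (p - 1)}" if p: "p \<in> {1..?n}" for p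
    proof -
      have "i = xs ! (p - 1)" if i: "i \<in> Bc p" "i \<in> set xs" for i
      proof -
        obtain q where q: "q < ?n" "i = xs ! q"
          using i(2) xs(2) by (auto simp: in_set_conv_nth)
        then have "i \<in> Bc (Suc q)" "Suc q \<in> {1..?n}"
          using nth by auto
        then have "Suc q = p"
          using i(1) p disjoint_family_onD[OF assms(6), of "Suc q" p] by blast
        then show ?thesis
          using q by auto
      qed
      moreover have "xs ! (p - 1) \<in> Bc p" "xs ! (p - 1) \<in> set xs"
        using nth[of "p - 1"] p xs(2) by auto
      ultimately show ?thesis
        by blast
    qed
    moreover have "(\<Sum>q = 1..?n. unit_vector q p) = 1" if "p \<in> {1..?n}" for p
      using that by (simp add: unit_vector_def)
    ultimately have "has_color_vector ?n Bc (squarefree_exponent (set xs))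
        (\<lambda>q. \<Sum>p = 1..?n. unit_vector p q)"
      unfolding has_color_vector_def by (simp add: keys_squarefree_exponent)
    moreover have "squarefree_monomial B (squarefree_exponent (set xs))"
      using sub by (simp add: squarefree_monomial_def keys_squarefree_exponent
          lookup_squarefree_exponent)
    moreover have "monom_poly (squarefree_exponent (set xs)) \<in> I\<^sub>N"
      unfolding assms(9) using sub nonface by (rule nonface_imp_monom_poly_in_ideal)
    ultimately show False
      using no_rainbow by blast
  qed

  define Y where "Y A = subcomplex_Inter X C A" for A
  have Y_iff: "F \<in> Y A \<longleftrightarrow> F \<in> X \<and> (\<forall>i\<in>A. F \<in> C i)" for F A
    by (auto simp: Y_def subcomplex_Inter_def)
  have Y_antimono: "Y A' \<subseteq> Y A" if "A \<subseteq> A'" for A A'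
    using that unfolding Y_iff subset_iff by blast
  have acyclic_Y: "acyclic_over TYPE('k) (Y A)" if "A \<in> ?N" for A
    using that assms(8) by (auto simp: Y_def nerve_def)
  have "{} \<in> ?N"
    using F0(1) F0_ne by (auto simp: nerve_def nonempty_complex_def subcomplex_Inter_def)
  then have acyclic_X: "acyclic_over TYPE('k) X"
    using acyclic_Y[of "{}"] by (simp add: Y_def subcomplex_Inter_def)
  have cube_N: "fixed e \<in> ?N"
    if "length e = ?n" "transversal col 0 (map side_label e)" for e
    using rainbow_face[of "map side_label e"] nerve_subset[OF _ fixed_label] that by simp
  have C_face: "G \<in> C i" if "i \<in> B" "F \<in> C i" "G face_of F" for F G i
    using face_in_induced_subcomplex[OF assms(1), of F] induced[OF that(1)] that(2,3) by auto

  \<comment> \<open>Boundaries are cycles because the two sets agree for the acyclic complex \<open>X\<close>; this is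
     applied to the chain of a single face.\<close>
  have square_zero: "(\<Sum>G\<in>X. ?inc F G * ?inc G H) = 0" if "F \<in> X" for F H
  proof -
    define z :: "'a set \<Rightarrow> 'k" where "z F' = of_bool (F' = F)" for F'
    have "z \<in> cell_chains X (aff_dim F - 1 + 1)"
      using that by (auto simp: z_def cell_chains_def)
    then have "cell_boundary X z \<in> cell_cycles X (aff_dim F - 1)"
      using acyclic_X unfolding acyclic_over_def reduced_homology_vanishes_def cell_boundaries_def
      by blast
    then have "cell_boundary X (cell_boundary X z) H = 0"
      by (simp add: cell_cycles_def)
    moreover have "cell_boundary X z = ?inc F"
      using that fin
      by (intro ext) (simp add: cell_boundary_def z_def of_bool_def if_distrib[where f = "\<lambda>x. _ * x"] cong: if_cong)
    ultimately show ?thesis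
      by (simp add: cell_boundary_def mult.commute)
  qed
  have incident: "G face_of F \<and> F \<noteq> {}" if "?inc F G \<noteq> 0" for F G
    using that incidence_nonzero[of F G] by (cases "incidence F G = 0") auto
  interpret coloured_complex X ?inc pt C col b
  proof
    show "finite (col p)" for p
      using assms(4) col_B finite_subset by blast
    show "G \<in> C x" if "?inc F G \<noteq> 0" "x \<in> col p" "F \<in> C x" for F G p x
      using C_face[of x F G] col_B[of p] incident[OF that(1)] that by blast
    show "pt F p \<in> col p" "F \<notin> C (pt F p)" if "F \<in> X" "?inc F G \<noteq> 0" for F G p
      using pt[of F p] that(1) incident[OF that(2)] by auto
  qed (use square_zero b in auto)

  have "\<exists>g :: 'i side list \<Rightarrow> 'a set \<Rightarrow> 'k. \<forall>e. length e = ?n \<longrightarrow>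
      transversal col 0 (map side_label e) \<longrightarrow> cube_dim e < ?n \<longrightarrow> cube_filling X Y b g e"
  proof (rule cube_filling_exists)
    fix e :: "'i side list"
    assume e: "length e = ?n" "transversal col 0 (map side_label e)"
    note N = cube_N[OF e]
    then have "fixed e \<subseteq> B"
      by (simp add: nerve_def)
    obtain F where "F \<in> Y (fixed e)"
      using N by (auto simp: nerve_def nonempty_complex_def Y_def)
    then have "{} \<in> C i" if "i \<in> fixed e" for i
      using C_face[of i F "{}"] \<open>fixed e \<subseteq> B\<close> that by (auto simp: Y_iff)
    then show "{} \<in> Y (fixed e)"
      using empty_X by (simp add: Y_iff)
    fix j and z :: "'a set \<Rightarrow> 'k"
    assume z: "z \<in> cell_chains (Y (fixed e)) j" "cell_boundary X z = (\<lambda>_. 0)"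
    have boundary: "cell_boundary (Y (fixed e)) y = cell_boundary X y"
      if "y \<in> cell_chains (Y (fixed e)) k" for y :: "'a set \<Rightarrow> 'k" and k
      using that fin by (intro cell_boundary_subcomplex) (auto simp: Y_iff)
    have "z \<in> cell_cycles (Y (fixed e)) j"
      using z boundary[OF z(1)] by (simp add: cell_cycles_def)
    then have "z \<in> cell_boundaries (Y (fixed e)) j"
      using acyclic_Y[OF N] by (simp add: acyclic_over_def reduced_homology_vanishes_def)
    then obtain y where "y \<in> cell_chains (Y (fixed e)) (j + 1)"
      "z = cell_boundary (Y (fixed e)) y"
      unfolding cell_boundaries_def by blast
    then show "\<exists>y\<in>cell_chains (Y (fixed e)) (j + 1). cell_boundary X y = z"
      using boundary by auto
  qed (use b Y_antimono in auto)
  then obtain g :: "'i side list \<Rightarrow> 'a set \<Rightarrow> 'k" where g: "\<And>e. length e = ?n \<Longrightarrow>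
      transversal col 0 (map side_label e) \<Longrightarrow> cube_dim e < ?n \<Longrightarrow> cube_filling X Y b g e"
    by blast
  have g_fixed: "cube_filling X Y b g e"
    if "length e = ?n" "transversal col 0 (map side_label e)" "fixed e \<noteq> {}" for e
    using g[of e] cube_dim_less[of e] that by simp

  have "carried ?n 0 g"
    unfolding carried_def
  proof (intro allI impI ballI)
    fix e F x
    assume "length e = ?n" "transversal col 0 (map side_label e)" "g e F \<noteq> 0" "x \<in> fixed e"
    then show "F \<in> C x"
      using g_fixed[of e] by (auto simp: cube_filling_def cell_chains_def Y_iff)
  qed
  moreover have "cubical_chain_map {} ?n 0 g"
    unfolding cubical_chain_map_def
  proof (intro allI impI)
    fix e G
    assume "length e = ?n" "transversal col 0 (map side_label e)" "fixed e \<noteq> {}"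
    then have "cell_boundary X (g e) G = attaching_chain b g e G"
      using g_fixed[of e] by (simp add: cube_filling_def)
    then show "(\<Sum>F\<in>X. ?inc F G * g e F) =
        (if cube_dim e = 0 then of_bool (G = {}) else cube_bd b 0 (\<lambda>e'. g e' G) e)"
      by (simp add: attaching_chain_def cell_boundary_def)
  qed
  ultimately have "tsum col ?n 0 (\<lambda>xs. cube_bd b 0
      (\<lambda>e. pairing ?n (rainbow_cochain 0 xs) (g e)) (map Edge xs)) = (- 1) ^ ?n"
    using top_evaluation[OF fin empty_X, of d 0 g] by simp
  moreover have "cube_bd b 0 (\<lambda>e. pairing ?n (rainbow_cochain 0 xs) (g e)) (map Edge xs) = 0"
    if xs: "transversal col 0 xs" "length xs = ?n" for xs
  proof -
    let ?e = "map Edge xs"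
    have filling: "cube_filling X Y b g e'" if e': "e' \<in> cube_faces b 0 ?e" for e'
    proof (rule g)
      show "length e' = ?n"
        using cube_faces_length[OF e'] xs by simp
      show "transversal col 0 (map side_label e')"
        using cube_faces_transversal[OF b e'] xs transversal_Edge by blast
      show "cube_dim e' < ?n"
        using cube_faces_dim[OF e'] xs by (simp add: cube_dim_Edge)
    qed
    have "attaching_chain b g ?e \<in> cell_chains (Y (fixed ?e)) (int (cube_dim ?e) - 1)"
      using empty_X by (intro attaching_chain_in_chains[OF filling Y_antimono]) (simp_all add: Y_iff)
    moreover have "cell_boundary X (attaching_chain b g ?e) = (\<lambda>_. 0)"
      by (rule cell_boundary_attaching_chain[OF filling])
    moreover have "Y {} = X"
      by (auto simp: Y_iff)
    ultimately have "attaching_chain b g ?e \<in> cell_cycles X (int d)"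
      using xs by (simp add: cell_cycles_def cube_dim_Edge)
    then obtain y :: "'a set \<Rightarrow> 'k"
      where y: "y \<in> cell_chains X (int d + 1)" "attaching_chain b g ?e = cell_boundary X y"
      using assms(3) unfolding reduced_homology_vanishes_def cell_boundaries_def by blast
    \<comment> \<open>There are no faces of dimension \<open>d + 1\<close>.\<close>
    have "y F = 0" for F
      using y(1) dim_le[of F] by (cases "y F = 0") (auto simp: cell_chains_def)
    then have "attaching_chain b g ?e F = 0" for F
      unfolding y(2) by (simp add: cell_boundary_def)
    then have "cube_bd b 0 (\<lambda>e. g e F) ?e = 0" for F
      using xs by (simp add: attaching_chain_def cube_dim_Edge split: if_splits)
    then show ?thesis
      unfolding pairing_cube_bd[symmetric] by (simp add: pairing_def)
  qed
  ultimately show False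
    by (subst (asm) tsum_eq_0) simp_all
qed

end
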